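(* Let $X$ be a discrete real random variable (taking finitely or countably infinitely many values). Then, for every real random variable $Z$ independent of $X$ having a bounded probability density function $f_Z$ such that $$f_Z(z)=o(|z|^{-1}),\qquad |z|\to\infty,$$ setting $Y=X+\sigma Z$ and $\mathcal{E}_\sigma=\frac{X-\mathbb{E}[X\mid Y]}{\sigma}$ for $\sigma>0$, $$\lim_{\sigma\to0}\mathcal{E}_\sigma=0\qquad\text{a.s.}$$
   Context: $\mathbb{E}[X\mid Y=y]=\int x\,\mathrm{d}P_{X|Y=y}(x)$, with $P_{X|Y=y}$ the conditional distribution. Equivalently $\mathcal{E}_\sigma=\mathbb{E}[Z\mid Y]-Z$, where the version of the conditional expectation used is, for every $\sigma>0$, $$\mathbb{E}[Z\mid Y=y]=\frac{\mathbb{E}\left[\frac{y-X}{\sigma}f_Z\left(\frac{y-X}{\sigma}\right)\right]}{\mathbb{E}\left[f_Z\left(\frac{y-X}{\sigma}\right)\right]}$$ (whenever the denominator is positive). *)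

theory Defs
  imports "HOL-Probability.Probability"
begin

text \<open>\<open>K\<close> is a regular conditional distribution of \<open>X\<close> given \<open>Y\<close>.\<close>

definition is_cond_distr ::
    "'a measure \<Rightarrow> ('a \<Rightarrow> real) \<Rightarrow> ('a \<Rightarrow> real) \<Rightarrow> (real \<Rightarrow> real measure) \<Rightarrow> bool" where
  "is_cond_distr M X Y K \<longleftrightarrow>
     K \<in> borel \<rightarrow>\<^sub>M prob_algebra borel \<and>
     (\<forall>A\<in>sets borel. \<forall>B\<in>sets borel.
        emeasure M {\<omega>\<in>space M. X \<omega> \<in> A \<and> Y \<omega> \<in> B} =
        (\<integral>\<^sup>+y\<in>B. emeasure (K y) A \<partial>distr M borel Y))"

definition noisy :: "('a \<Rightarrow> real) \<Rightarrow> ('a \<Rightarrow> real) \<Rightarrow> real \<Rightarrow> 'a \<Rightarrow> real" where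
  "noisy X Z \<sigma> \<omega> = X \<omega> + \<sigma> * Z \<omega>"

text \<open>
  Conditional distributions are determined only almost everywhere, for each \<open>\<sigma>\<close> separately, while
  a limit as \<open>\<sigma>\<close> tends to \<open>0\<close> involves uncountably many \<open>\<sigma>\<close>. So a version has to be fixed: the
  one given by Bayes' formula, where \<open>f\<close> is the density of \<open>Z\<close>. The value where the normalising
  constant vanishes is a dummy. Lemmas \<open>is_cond_distr_cond_distr\<close> and
  \<open>scaled_error_eq\<close> below justify this choice.
\<close>
definition cond_distr ::
    "'a measure \<Rightarrow> ('a \<Rightarrow> real) \<Rightarrow> (real \<Rightarrow> real) \<Rightarrow> real \<Rightarrow> real \<Rightarrow> real measure" where
  "cond_distr M X f \<sigma> y =
     (let D = (\<integral>\<omega>. f ((y - X \<omega>) / \<sigma>) \<partial>M) in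
      if 0 < D then density (distr M borel X) (\<lambda>x. ennreal (f ((y - x) / \<sigma>) / D))
      else distr M borel X)"

definition cond_mean ::
    "'a measure \<Rightarrow> ('a \<Rightarrow> real) \<Rightarrow> (real \<Rightarrow> real) \<Rightarrow> real \<Rightarrow> real \<Rightarrow> real" where
  "cond_mean M X f \<sigma> y = (\<integral>x. x \<partial>cond_distr M X f \<sigma> y)"

definition scaled_error ::
    "'a measure \<Rightarrow> ('a \<Rightarrow> real) \<Rightarrow> ('a \<Rightarrow> real) \<Rightarrow> (real \<Rightarrow> real) \<Rightarrow> real \<Rightarrow> 'a \<Rightarrow> real" where
  "scaled_error M X Z f \<sigma> \<omega> = (X \<omega> - cond_mean M X f \<sigma> (noisy X Z \<sigma> \<omega>)) / \<sigma>"

lemma is_cond_distr_cond_distr: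
  assumes "prob_space M"
    and X: "X \<in> borel_measurable M"
    and ind: "prob_space.indep_var M borel X borel Z"
    and nonneg: "\<forall>z. 0 \<le> f z"
    and Z: "distributed M lborel Z (\<lambda>z. ennreal (f z))"
    and bdd: "bounded (range f)"
    and \<sigma>: "0 < \<sigma>"
  shows "is_cond_distr M X (noisy X Z \<sigma>) (cond_distr M X f \<sigma>)"
proof -
  interpret prob_space M by fact
  note [measurable] = X
  have [measurable]: "Z \<in> borel_measurable M"
    using distributed_measurable[OF Z] by simp
  have [measurable]: "f \<in> borel_measurable borel"
    using distributed_real_measurable[of lborel f M Z] Z nonneg by simp
  define P where "P = distr M borel X"
  interpret P: prob_space P unfolding P_def by (rule prob_space_distr) simp
  have [measurable_cong, simp]: "sets P = sets borel" and [simp]: "space P = UNIV"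
    by (simp_all add: P_def)
  obtain C where C: "\<And>z. \<bar>f z\<bar> \<le> C" using bdd unfolding bounded_iff by auto
  define D where "D y = (\<integral>x. f ((y - x) / \<sigma>) \<partial>P)" for y
  have D_M: "(\<integral>\<omega>. f ((y - X \<omega>) / \<sigma>) \<partial>M) = D y" for y
    unfolding D_def P_def by (subst integral_distr) auto
  have int: "integrable P (\<lambda>x. f ((y - x) / \<sigma>))" for y
    by (rule P.integrable_const_bound[where B=C]) (auto simp: C)
  have D_nn: "(\<integral>\<^sup>+x. ennreal (f ((y - x) / \<sigma>)) \<partial>P) = ennreal (D y)" for y
    unfolding D_def by (rule nn_integral_eq_integral[OF int]) (simp add: nonneg)
  have D_nonneg: "0 \<le> D y" for y
    unfolding D_def using nonneg by (intro integral_nonneg_AE) auto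
  have [measurable]: "D \<in> borel_measurable borel"
    unfolding D_def by measurable
  let ?K = "cond_distr M X f \<sigma>"
  have K: "?K y = (if 0 < D y then density P (\<lambda>x. ennreal (f ((y - x) / \<sigma>) / D y)) else P)" for y
    unfolding cond_distr_def Let_def D_M P_def ..
  have em: "emeasure (?K y) A =
      (if 0 < D y then (\<integral>\<^sup>+x. ennreal (f ((y - x) / \<sigma>) / D y) * indicator A x \<partial>P)
       else emeasure P A)" if [measurable]: "A \<in> sets borel" for y A
    unfolding K by (simp add: emeasure_density)
  have mult: "ennreal (D y) * emeasure (?K y) A =
      (\<integral>\<^sup>+x. ennreal (f ((y - x) / \<sigma>)) * indicator A x \<partial>P)"
    if [measurable]: "A \<in> sets borel" for y A
  proof (cases "0 < D y")
    case True
    have "ennreal (D y) * emeasure (?K y) A =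
        (\<integral>\<^sup>+x. ennreal (D y) * (ennreal (f ((y - x) / \<sigma>) / D y) * indicator A x) \<partial>P)"
      unfolding em[OF that] using True by (simp add: nn_integral_cmult)
    also have "\<dots> = (\<integral>\<^sup>+x. ennreal (f ((y - x) / \<sigma>)) * indicator A x \<partial>P)"
      using True nonneg by (intro nn_integral_cong)
        (simp add: mult.assoc[symmetric] ennreal_mult[symmetric])
    finally show ?thesis .
  next
    case False
    then have "D y = 0" using D_nonneg[of y] by simp
    have "(\<integral>\<^sup>+x. ennreal (f ((y - x) / \<sigma>)) * indicator A x \<partial>P)
        \<le> (\<integral>\<^sup>+x. ennreal (f ((y - x) / \<sigma>)) \<partial>P)"
      by (intro nn_integral_mono) (auto split: split_indicator)
    then show ?thesis using D_nn[of y] \<open>D y = 0\<close> by simp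
  qed
  have prob: "prob_space (?K y)" for y
  proof (cases "0 < D y")
    case True
    have "ennreal (D y) * emeasure (?K y) UNIV = ennreal (D y) * 1"
      using mult[of UNIV y] D_nn[of y] by simp
    with True have "emeasure (?K y) UNIV = 1"
      by (subst (asm) ennreal_mult_cancel_left) (simp add: ennreal_eq_0_iff)
    then show ?thesis by (intro prob_spaceI) (simp add: K True)
  next
    case False
    then show ?thesis by (simp add: K P.prob_space_axioms)
  qed
  have meas: "(\<lambda>y. emeasure (?K y) A) \<in> borel_measurable borel"
    if [measurable]: "A \<in> sets borel" for A
    unfolding em[OF that] by measurable
  have kern: "?K \<in> borel \<rightarrow>\<^sub>M prob_algebra borel"
  proof (rule measurable_prob_algebraI)
    show "?K \<in> borel \<rightarrow>\<^sub>M subprob_algebra borel"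
    proof (rule measurable_subprob_algebra)
      show "subprob_space (?K y)" for y
        using prob by (rule prob_space_imp_subprob_space)
      show "sets (?K y) = sets borel" for y by (simp add: K)
    qed (rule meas)
  qed (rule prob)
  have joint: "distr M (borel \<Otimes>\<^sub>M borel) (\<lambda>\<omega>. (X \<omega>, Z \<omega>)) = P \<Otimes>\<^sub>M density lborel f"
    using indep_var_distribution_eq[of borel X borel Z] ind distributed_distr_eq_density[OF Z]
    by (simp add: P_def cong: distr_cong)
  have fin: "sigma_finite_measure (density lborel f)"
  proof -
    have "distr M lborel Z = density lborel f" by (rule distributed_distr_eq_density[OF Z])
    moreover have "prob_space (distr M lborel Z)" by (rule prob_space_distr) simp
    ultimately show ?thesis by (metis prob_space_imp_sigma_finite)
  qed
  interpret Q: sigma_finite_measure "density lborel f" by fact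
  interpret PL: pair_sigma_finite P lborel ..
  have XY: "(\<integral>\<^sup>+\<omega>. h (X \<omega>) (noisy X Z \<sigma> \<omega>) \<partial>M) =
      ennreal (1 / \<sigma>) * (\<integral>\<^sup>+y. (\<integral>\<^sup>+x. h x y * ennreal (f ((y - x) / \<sigma>)) \<partial>P) \<partial>lborel)"
    if [measurable]: "case_prod h \<in> borel_measurable (borel \<Otimes>\<^sub>M borel)" for h :: "real \<Rightarrow> real \<Rightarrow> ennreal"
  proof -
    have "(\<integral>\<^sup>+\<omega>. h (X \<omega>) (noisy X Z \<sigma> \<omega>) \<partial>M) =
        (\<integral>\<^sup>+p. h (fst p) (fst p + \<sigma> * snd p) \<partial>distr M (borel \<Otimes>\<^sub>M borel) (\<lambda>\<omega>. (X \<omega>, Z \<omega>)))"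
      unfolding noisy_def by (subst nn_integral_distr) auto
    also have "\<dots> = (\<integral>\<^sup>+x. \<integral>\<^sup>+z. h x (x + \<sigma> * z) \<partial>density lborel f \<partial>P)"
      unfolding joint by (subst Q.nn_integral_fst[symmetric]) auto
    also have "\<dots> = (\<integral>\<^sup>+x. \<integral>\<^sup>+z. ennreal (f z) * h x (x + \<sigma> * z) \<partial>lborel \<partial>P)"
      by (intro nn_integral_cong, subst nn_integral_density) auto
    also have "\<dots> = (\<integral>\<^sup>+x. ennreal (1 / \<sigma>) * (\<integral>\<^sup>+y. h x y * ennreal (f ((y - x) / \<sigma>)) \<partial>lborel) \<partial>P)"
    proof (intro nn_integral_cong)
      fix x
      have "(\<integral>\<^sup>+y. h x y * ennreal (f ((y - x) / \<sigma>)) \<partial>lborel) =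
          ennreal \<sigma> * (\<integral>\<^sup>+z. h x (x + \<sigma> * z) * ennreal (f z) \<partial>lborel)"
        using \<sigma> by (subst nn_integral_real_affine[where c=\<sigma> and t=x]) auto
      then show "(\<integral>\<^sup>+z. ennreal (f z) * h x (x + \<sigma> * z) \<partial>lborel) =
          ennreal (1 / \<sigma>) * (\<integral>\<^sup>+y. h x y * ennreal (f ((y - x) / \<sigma>)) \<partial>lborel)"
        using \<sigma> by (simp add: mult.assoc[symmetric] ennreal_mult[symmetric] mult.commute)
    qed
    also have "\<dots> = ennreal (1 / \<sigma>) * (\<integral>\<^sup>+x. \<integral>\<^sup>+y. h x y * ennreal (f ((y - x) / \<sigma>)) \<partial>lborel \<partial>P)"
      by (rule nn_integral_cmult) measurable
    also have "(\<integral>\<^sup>+x. \<integral>\<^sup>+y. h x y * ennreal (f ((y - x) / \<sigma>)) \<partial>lborel \<partial>P) =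
        (\<integral>\<^sup>+y. \<integral>\<^sup>+x. h x y * ennreal (f ((y - x) / \<sigma>)) \<partial>P \<partial>lborel)"
      by (rule PL.Fubini'[symmetric]) measurable
    finally show ?thesis .
  qed
  have "emeasure M {\<omega>\<in>space M. X \<omega> \<in> A \<and> noisy X Z \<sigma> \<omega> \<in> B} =
        (\<integral>\<^sup>+y\<in>B. emeasure (?K y) A \<partial>distr M borel (noisy X Z \<sigma>))"
    if [measurable]: "A \<in> sets borel" "B \<in> sets borel" for A B
  proof -
    note [measurable] = meas[OF that(1)]
    have [measurable]: "noisy X Z \<sigma> \<in> borel_measurable M"
      unfolding noisy_def[abs_def] by measurable
    have "emeasure M {\<omega>\<in>space M. X \<omega> \<in> A \<and> noisy X Z \<sigma> \<omega> \<in> B} =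
        (\<integral>\<^sup>+\<omega>. indicator A (X \<omega>) * indicator B (noisy X Z \<sigma> \<omega>) \<partial>M)"
    proof -
      have "{\<omega>\<in>space M. X \<omega> \<in> A \<and> noisy X Z \<sigma> \<omega> \<in> B} \<in> sets M" by measurable
      from nn_integral_indicator[OF this, symmetric] show ?thesis
        by (rule trans) (intro nn_integral_cong, auto split: split_indicator)
    qed
    also have "\<dots> = ennreal (1 / \<sigma>) *
        (\<integral>\<^sup>+y. (\<integral>\<^sup>+x. (indicator A x * indicator B y) * ennreal (f ((y - x) / \<sigma>)) \<partial>P) \<partial>lborel)"
      by (rule XY) measurable
    also have "(\<lambda>y. \<integral>\<^sup>+x. (indicator A x * indicator B y) * ennreal (f ((y - x) / \<sigma>)) \<partial>P) =
        (\<lambda>y. \<integral>\<^sup>+x. (emeasure (?K y) A * indicator B y) * ennreal (f ((y - x) / \<sigma>)) \<partial>P)"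
    proof
      fix y
      have "(\<integral>\<^sup>+x. (indicator A x * indicator B y) * ennreal (f ((y - x) / \<sigma>)) \<partial>P) =
          indicator B y * (\<integral>\<^sup>+x. ennreal (f ((y - x) / \<sigma>)) * indicator A x \<partial>P)"
        by (subst nn_integral_cmult[symmetric]) (auto simp: ac_simps)
      also have "\<dots> = (emeasure (?K y) A * indicator B y) * ennreal (D y)"
        unfolding mult[OF that(1), symmetric] by (simp add: ac_simps)
      also have "\<dots> = (\<integral>\<^sup>+x. (emeasure (?K y) A * indicator B y) * ennreal (f ((y - x) / \<sigma>)) \<partial>P)"
        unfolding D_nn[symmetric] by (subst nn_integral_cmult) auto
      finally show "(\<integral>\<^sup>+x. (indicator A x * indicator B y) * ennreal (f ((y - x) / \<sigma>)) \<partial>P) =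
          (\<integral>\<^sup>+x. (emeasure (?K y) A * indicator B y) * ennreal (f ((y - x) / \<sigma>)) \<partial>P)" .
    qed
    also have "ennreal (1 / \<sigma>) *
        (\<integral>\<^sup>+y. (\<integral>\<^sup>+x. (emeasure (?K y) A * indicator B y) * ennreal (f ((y - x) / \<sigma>)) \<partial>P) \<partial>lborel) =
        (\<integral>\<^sup>+\<omega>. emeasure (?K (noisy X Z \<sigma> \<omega>)) A * indicator B (noisy X Z \<sigma> \<omega>) \<partial>M)"
      by (rule XY[symmetric]) measurable
    also have "\<dots> = (\<integral>\<^sup>+y\<in>B. emeasure (?K y) A \<partial>distr M borel (noisy X Z \<sigma>))"
      by (subst nn_integral_distr) auto
    finally show ?thesis .
  qed
  with kern show ?thesis unfolding is_cond_distr_def by blast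
qed

lemma scaled_error_eq:
  assumes "prob_space M"
    and X: "X \<in> borel_measurable M"
    and meas: "f \<in> borel_measurable borel"
    and nonneg: "\<forall>z. 0 \<le> f z"
    and bdd: "bounded (range f)"
    and decay: "f \<in> o[at_infinity](\<lambda>z. 1 / \<bar>z\<bar>)"
    and \<sigma>: "0 < \<sigma>"
    and y: "y = noisy X Z \<sigma> \<omega>"
    and pos: "0 < (\<integral>\<omega>. f ((y - X \<omega>) / \<sigma>) \<partial>M)"
  shows "scaled_error M X Z f \<sigma> \<omega> =
    (\<integral>\<omega>. (y - X \<omega>) / \<sigma> * f ((y - X \<omega>) / \<sigma>) \<partial>M) / (\<integral>\<omega>. f ((y - X \<omega>) / \<sigma>) \<partial>M) - Z \<omega>"
proof -
  interpret prob_space M by fact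
  note [measurable] = X meas
  obtain C where C: "\<And>z. \<bar>f z\<bar> \<le> C" using bdd unfolding bounded_iff by auto
  have C0: "0 \<le> C" using C[of 0] by linarith
  have "\<forall>\<^sub>F z in at_infinity. norm (f z) \<le> 1 * norm (1 / \<bar>z\<bar>)"
    using decay by (rule landau_o.smallD) simp
  then obtain b where b: "\<And>z. b \<le> \<bar>z\<bar> \<Longrightarrow> \<bar>f z\<bar> \<le> 1 / \<bar>z\<bar>"
    unfolding eventually_at_infinity by auto
  have zf: "\<bar>z * f z\<bar> \<le> max 1 (\<bar>b\<bar> * C)" for z
  proof (cases "b \<le> \<bar>z\<bar> \<and> z \<noteq> 0")
    case True
    then have "\<bar>z\<bar> * \<bar>f z\<bar> \<le> \<bar>z\<bar> * (1 / \<bar>z\<bar>)" using b by (intro mult_left_mono) auto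
    then show ?thesis using True by (simp add: abs_mult)
  next
    case False
    then have "\<bar>z\<bar> * \<bar>f z\<bar> \<le> \<bar>b\<bar> * C" using C C0 by (intro mult_mono) auto
    then show ?thesis by (simp add: abs_mult)
  qed
  define D where "D = (\<integral>\<omega>. f ((y - X \<omega>) / \<sigma>) \<partial>M)"
  define N where "N = (\<integral>\<omega>. (y - X \<omega>) / \<sigma> * f ((y - X \<omega>) / \<sigma>) \<partial>M)"
  have D: "0 < D" using pos by (simp add: D_def)
  have i1: "integrable M (\<lambda>\<omega>. f ((y - X \<omega>) / \<sigma>))"
    by (rule integrable_const_bound[where B=C]) (auto simp: C)
  have i2: "integrable M (\<lambda>\<omega>. (y - X \<omega>) / \<sigma> * f ((y - X \<omega>) / \<sigma>))"
    by (rule integrable_const_bound[where B="max 1 (\<bar>b\<bar> * C)"])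
      (use zf in \<open>auto simp del: times_divide_eq_left\<close>)
  have "cond_mean M X f \<sigma> y = (\<integral>x. f ((y - x) / \<sigma>) / D * x \<partial>distr M borel X)"
    unfolding cond_mean_def cond_distr_def Let_def D_def[symmetric] using D nonneg
    by (simp add: integral_density)
  also have "\<dots> = (\<integral>\<omega>. f ((y - X \<omega>) / \<sigma>) / D * X \<omega> \<partial>M)"
    by (rule integral_distr) auto
  also have "\<dots> = (\<integral>\<omega>. y / D * f ((y - X \<omega>) / \<sigma>)
      - \<sigma> / D * ((y - X \<omega>) / \<sigma> * f ((y - X \<omega>) / \<sigma>)) \<partial>M)"
    using \<sigma> D by (intro Bochner_Integration.integral_cong) (auto simp: field_simps)
  also have "\<dots> = y / D * D - \<sigma> / D * N"
    unfolding Bochner_Integration.integral_diff[OF integrable_mult_right[OF i1]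
        integrable_mult_right[OF i2]] integral_mult_right_zero D_def N_def ..
  finally have "cond_mean M X f \<sigma> y = y - \<sigma> * (N / D)" using D by simp
  moreover have "X \<omega> = y - \<sigma> * Z \<omega>" by (simp add: y noisy_def)
  ultimately have "scaled_error M X Z f \<sigma> \<omega> = N / D - Z \<omega>"
    unfolding scaled_error_def y[symmetric] using \<sigma> by (simp add: field_simps)
  then show ?thesis unfolding N_def D_def .
qed

end

theory Submission
  imports Defs
begin

text \<open>
  Almost surely \<open>x = X \<omega>\<close> is an atom of \<open>X\<close>, of mass \<open>p > 0\<close>, and \<open>z = Z \<omega>\<close> satisfies
  \<open>f z > 0\<close>. With \<open>y = x + \<sigma> z\<close> and \<open>X'\<close> distributed as \<open>X\<close>, the argument \<open>(y - X') / \<sigma>\<close> equals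
  \<open>z + U\<close> with \<open>U = (x - X') / \<sigma>\<close>, so Bayes' formula turns the error into
  \<open>E[U f (z + U)] / E[f (z + U)]\<close>. The denominator is at least \<open>p f z\<close> for every \<open>\<sigma>\<close>. In the
  numerator, \<open>u f (z + u)\<close> is bounded, vanishes at \<open>u = 0\<close> and tends to \<open>0\<close> at infinity, and \<open>U\<close>
  is \<open>0\<close> or diverges as \<open>\<sigma>\<close> tends to \<open>0\<close>; dominated convergence makes the numerator vanish.
\<close>

lemma (in finite_measure) integral_rescaled_tendsto_0:
  fixes g V :: "_ \<Rightarrow> real"
  assumes [measurable]: "g \<in> borel_measurable borel" "V \<in> borel_measurable M"
    and bdd: "bounded (range g)"
    and g0: "g 0 = 0"
    and lim: "(g \<longlongrightarrow> 0) at_infinity"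
  shows "((\<lambda>\<sigma>. \<integral>\<omega>. g (V \<omega> / \<sigma>) \<partial>M) \<longlongrightarrow> 0) (at_right 0)"
proof -
  obtain C where C: "\<And>u. \<bar>g u\<bar> \<le> C" using bdd unfolding bounded_iff by auto
  \<comment> \<open>Here \<open>t\<close> stands for the reciprocal of \<sigma>, so that the limit
    is taken at infinity. The constant \<open>C\<close> is an integrable majorant because the
    measure is finite.\<close>
  have "((\<lambda>t. \<integral>\<omega>. g (V \<omega> * t) \<partial>M) \<longlongrightarrow> (\<integral>\<omega>. 0 \<partial>M)) at_top"
  proof (rule integral_dominated_convergence_at_top[where w = "\<lambda>_. C"])
    show "AE \<omega> in M. ((\<lambda>t. g (V \<omega> * t)) \<longlongrightarrow> 0) at_top"
    proof (rule AE_I2)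
      fix \<omega>
      show "((\<lambda>t. g (V \<omega> * t)) \<longlongrightarrow> 0) at_top"
      proof (cases "V \<omega> = 0")
        case False
        then have "filterlim (\<lambda>t. V \<omega> * t) at_infinity at_top"
          by (intro tendsto_mult_filterlim_at_infinity[OF tendsto_const])
            (auto intro: filterlim_at_top_imp_at_infinity filterlim_ident)
        then show ?thesis by (rule filterlim_compose[OF lim])
      qed (simp add: g0)
    qed
  qed (auto simp: C)
  then show ?thesis
    unfolding filterlim_at_right_to_top[where F = "nhds _"] by (simp add: divide_inverse)
qed

text \<open>Split \<open>u * f (z + u)\<close> as
  \<open>(z + u) * f (z + u) - z * f (z + u)\<close>: the first term vanishes at infinity by the
  decay hypothesis, the second because that decay also forces \<open>f\<close> itself to vanish
  there.\<close>

lemma smallo_inverse_shift: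
  fixes f :: "real \<Rightarrow> real"
  assumes bdd: "bounded (range f)"
    and decay: "f \<in> o[at_infinity](\<lambda>z. 1 / \<bar>z\<bar>)"
  shows "((\<lambda>u. u * f (z + u)) \<longlongrightarrow> 0) at_infinity"
    and "bounded (range (\<lambda>u. u * f (z + u)))"
proof -
  have ev: "\<forall>\<^sub>F z in at_infinity. (z::real) \<noteq> 0"
    unfolding eventually_at_infinity by (intro exI[of _ 1]) auto
  have "((\<lambda>z. f z / (1 / \<bar>z\<bar>)) \<longlongrightarrow> 0) at_infinity"
    using decay by (rule smalloD_tendsto)
  then have "((\<lambda>z. \<bar>z * f z\<bar>) \<longlongrightarrow> 0) at_infinity"
    using tendsto_rabs_zero_iff[of "\<lambda>z. f z / (1 / \<bar>z\<bar>)"] by (simp add: abs_mult mult.commute)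
  then have zf: "((\<lambda>z. z * f z) \<longlongrightarrow> 0) at_infinity"
    by (simp only: tendsto_rabs_zero_iff)
  have "((\<lambda>z. inverse z * (z * f z)) \<longlongrightarrow> 0 * 0) at_infinity"
    by (intro tendsto_mult tendsto_inverse_0 zf)
  moreover have "\<forall>\<^sub>F z in at_infinity. inverse z * (z * f z) = f z"
    using ev by eventually_elim simp
  ultimately have f0: "(f \<longlongrightarrow> 0) at_infinity"
    using Lim_transform_eventually by fastforce
  have shift: "filterlim (\<lambda>u. z + u) at_infinity at_infinity"
    by (rule tendsto_add_filterlim_at_infinity[OF tendsto_const filterlim_ident])
  have "((\<lambda>u. (z + u) * f (z + u) - z * f (z + u)) \<longlongrightarrow> 0 - z * 0) at_infinity"
    by (intro tendsto_intros filterlim_compose[OF zf shift] filterlim_compose[OF f0 shift])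
  then show lim: "((\<lambda>u. u * f (z + u)) \<longlongrightarrow> 0) at_infinity"
    by (simp add: algebra_simps)
  obtain C where C: "\<And>z. \<bar>f z\<bar> \<le> C" using bdd unfolding bounded_iff by auto
  have "0 \<le> C" using C[of 0] by linarith
  \<comment> \<open>Beyond \<open>b\<close> the limit just proved gives the bound 1; within it
    \<open>\<bar>b\<bar> * C\<close> works.\<close>
  obtain b where b: "\<And>u. b \<le> \<bar>u\<bar> \<Longrightarrow> \<bar>u * f (z + u)\<bar> < 1"
    using tendstoD[OF lim, of 1] unfolding eventually_at_infinity by auto
  have "\<bar>u * f (z + u)\<bar> \<le> max 1 (\<bar>b\<bar> * C)" for u
  proof (cases "b \<le> \<bar>u\<bar>")
    case False
    then have "\<bar>u\<bar> * \<bar>f (z + u)\<bar> \<le> \<bar>b\<bar> * C" using C \<open>0 \<le> C\<close> by (intro mult_mono) auto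
    then show ?thesis by (simp add: abs_mult)
  qed (use b[of u] in simp)
  then show "bounded (range (\<lambda>u. u * f (z + u)))"
    unfolding bounded_iff by (intro exI[of _ "max 1 (\<bar>b\<bar> * C)"]) auto
qed

text \<open>A value of mass zero is attained only on a null set, and countably many such null sets,
  one for each point of \<open>S\<close>, still form a null set.\<close>

lemma (in finite_measure) AE_atom_pos:
  fixes X :: "'a \<Rightarrow> real"
  assumes [measurable]: "X \<in> borel_measurable M"
    and "countable S" and S: "AE \<omega> in M. X \<omega> \<in> S"
  shows "AE \<omega> in M. 0 < measure M {\<omega>' \<in> space M. X \<omega>' = X \<omega>}"
proof -
  have "AE \<omega> in M. X \<omega> = s \<longrightarrow> 0 < measure M {\<omega>' \<in> space M. X \<omega>' = s}" for s
  proof (cases "measure M {\<omega>' \<in> space M. X \<omega>' = s} = 0")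
    case True
    then have "AE \<omega> in M. X \<omega> \<noteq> s"
      by (subst AE_iff_measurable[OF _ refl]) (auto simp: emeasure_eq_measure)
    then show ?thesis by eventually_elim simp
  qed (simp add: zero_less_measure_iff)
  then have "AE \<omega> in M. \<forall>s\<in>S. X \<omega> = s \<longrightarrow> 0 < measure M {\<omega>' \<in> space M. X \<omega>' = s}"
    unfolding AE_ball_countable[OF \<open>countable S\<close>] by blast
  with S show ?thesis by eventually_elim auto
qed

lemma AE_distributed_density_pos:
  assumes Z: "distributed M N Z f"
  shows "AE \<omega> in M. 0 < f (Z \<omega>)"
proof -
  note [measurable] = distributed_borel_measurable[OF Z] distributed_measurable[OF Z]
  \<comment> \<open>Almost everywhere for \<open>density N f\<close> means almost everywhere for
    \<open>N\<close> where \<open>f\<close> is positive, which makes this claim trivial.\<close>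
  have "AE z in density N f. 0 < f z"
    by (simp add: AE_density)
  then have "AE z in distr M N Z. 0 < f z"
    unfolding distributed_distr_eq_density[OF Z] .
  then show ?thesis by (simp add: AE_distr_iff)
qed

text \<open>The deterministic core: with \<omega> fixed, the chance in the statement is confined to
  \<open>atom\<close> and \<open>fZ\<close>, and \<omega>' runs over the integration space.\<close>

lemma scaled_error_tendsto_0:
  fixes X Z :: "'a \<Rightarrow> real"
  assumes "prob_space M"
    and X: "X \<in> borel_measurable M"
    and f: "f \<in> borel_measurable borel"
    and nonneg: "\<forall>z. 0 \<le> f z"
    and bdd: "bounded (range f)"
    and decay: "f \<in> o[at_infinity](\<lambda>z. 1 / \<bar>z\<bar>)"
    and atom: "0 < measure M {\<omega>' \<in> space M. X \<omega>' = X \<omega>}"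
    and fZ: "0 < f (Z \<omega>)"
  shows "((\<lambda>\<sigma>. scaled_error M X Z f \<sigma> \<omega>) \<longlongrightarrow> 0) (at_right 0)"
proof -
  interpret prob_space M by fact
  note [measurable] = X f
  define x z where "x = X \<omega>" and "z = Z \<omega>"
  define A where "A = {\<omega>' \<in> space M. X \<omega>' = x}"
  have [measurable]: "A \<in> sets M" unfolding A_def by measurable
  obtain C where C: "\<And>z. \<bar>f z\<bar> \<le> C" using bdd unfolding bounded_iff by auto
  define D where "D \<sigma> = (\<integral>\<omega>'. f (z + (x - X \<omega>') / \<sigma>) \<partial>M)" for \<sigma>
  define G where "G \<sigma> = (\<integral>\<omega>'. (x - X \<omega>') / \<sigma> * f (z + (x - X \<omega>') / \<sigma>) \<partial>M)" for \<sigma>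
  define p where "p = f z * measure M A"
  have "0 < p" using atom fZ by (simp add: p_def A_def x_def z_def)
  have i1: "integrable M (\<lambda>\<omega>'. f (z + (x - X \<omega>') / \<sigma>))" for \<sigma>
    by (rule integrable_const_bound[where B = C]) (auto simp: C)
  obtain C' where C': "\<And>u. \<bar>u * f (z + u)\<bar> \<le> C'"
    using smallo_inverse_shift(2)[OF bdd decay, of z] unfolding bounded_iff by auto
  have i2: "integrable M (\<lambda>\<omega>'. (x - X \<omega>') / \<sigma> * f (z + (x - X \<omega>') / \<sigma>))" for \<sigma>
    by (rule integrable_const_bound[where B = C'])
      (use C' in \<open>auto simp del: times_divide_eq_left\<close>)
  have D: "p \<le> D \<sigma>" for \<sigma>
  proof -
    \<comment> \<open>On \<open>A\<close> the argument of \<open>f\<close> collapses to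
      \<open>z\<close> whatever \<sigma> is; off \<open>A\<close> the integrand is
      nonnegative.\<close>
    have "p = (\<integral>\<omega>'. f z * indicator A \<omega>' \<partial>M)" by (simp add: p_def)
    also have "\<dots> \<le> D \<sigma>"
      unfolding D_def using nonneg
      by (intro integral_mono i1 integrable_mult_right integrable_real_indicator)
        (auto simp: A_def less_top[symmetric] split: split_indicator)
    finally show ?thesis .
  qed
  have eq: "scaled_error M X Z f \<sigma> \<omega> = G \<sigma> / D \<sigma>" if \<sigma>: "0 < \<sigma>" for \<sigma>
  proof -
    let ?y = "noisy X Z \<sigma> \<omega>"
    have y: "(?y - X \<omega>') / \<sigma> = z + (x - X \<omega>') / \<sigma>" for \<omega>'
      using \<sigma> by (simp add: noisy_def x_def z_def field_simps)
    have pos: "0 < D \<sigma>" using D[of \<sigma>] \<open>0 < p\<close> by linarith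
    have "scaled_error M X Z f \<sigma> \<omega> =
        (\<integral>\<omega>'. (z + (x - X \<omega>') / \<sigma>) * f (z + (x - X \<omega>') / \<sigma>) \<partial>M) / D \<sigma> - z"
      using scaled_error_eq[OF \<open>prob_space M\<close> X f nonneg bdd decay \<sigma> refl, of Z \<omega>] pos
      unfolding y D_def z_def by simp
    \<comment> \<open>The summand \<open>z\<close> contributes \<open>z * D \<sigma>\<close>, which
      cancels the subtracted \<open>Z \<omega>\<close> after division. What remains has an integrand
      vanishing where \<open>X \<omega>' = x\<close>.\<close>
    also have "(\<integral>\<omega>'. (z + (x - X \<omega>') / \<sigma>) * f (z + (x - X \<omega>') / \<sigma>) \<partial>M) = z * D \<sigma> + G \<sigma>"
      unfolding distrib_right
        Bochner_Integration.integral_add[OF integrable_mult_right[OF i1] i2]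
        integral_mult_right_zero D_def G_def ..
    also have "(z * D \<sigma> + G \<sigma>) / D \<sigma> - z = G \<sigma> / D \<sigma>" using pos by (simp add: field_simps)
    finally show ?thesis .
  qed
  have "(G \<longlongrightarrow> 0) (at_right 0)"
    unfolding G_def
    by (rule integral_rescaled_tendsto_0[where g = "\<lambda>u. u * f (z + u)" and V = "\<lambda>\<omega>'. x - X \<omega>'"])
      (use smallo_inverse_shift[OF bdd decay, of z] in auto)
  \<comment> \<open>The uniform lower bound \<open>p\<close> replaces \<open>D \<sigma>\<close>, so
    no limit of the denominator has to be found.\<close>
  then have "((\<lambda>\<sigma>. \<bar>G \<sigma>\<bar> / p) \<longlongrightarrow> 0) (at_right 0)"
    using \<open>0 < p\<close> by (auto intro!: tendsto_eq_intros)
  moreover have "\<forall>\<^sub>F \<sigma> in at_right 0. norm (scaled_error M X Z f \<sigma> \<omega>) \<le> \<bar>G \<sigma>\<bar> / p"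
    using eventually_at_right_less[of "0::real"]
  proof eventually_elim
    case (elim \<sigma>)
    show ?case
      using D[of \<sigma>] \<open>0 < p\<close> by (simp add: eq[OF elim] frac_le)
  qed
  ultimately show ?thesis by (rule Lim_null_comparison[rotated])
qed

theorem theorem4:
  fixes M :: "'a measure"
    and X Z :: "'a \<Rightarrow> real"
    and f :: "real \<Rightarrow> real"
  assumes "prob_space M"
    and "X \<in> borel_measurable M"
    and "\<exists>S. countable S \<and> (AE \<omega> in M. X \<omega> \<in> S)"
    and "Z \<in> borel_measurable M"
    and "prob_space.indep_var M borel X borel Z"
    and "\<forall>z. 0 \<le> f z"
    and "distributed M lborel Z (\<lambda>z. ennreal (f z))"
    and "bounded (range f)"
    and "f \<in> o[at_infinity](\<lambda>z. 1 / \<bar>z\<bar>)"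
  shows "AE \<omega> in M. ((\<lambda>\<sigma>. scaled_error M X Z f \<sigma> \<omega>) \<longlongrightarrow> 0) (at_right 0)"
proof -
  interpret prob_space M by fact
  have f: "f \<in> borel_measurable borel"
    using distributed_real_measurable[of lborel f M Z] assms(6,7) by simp
  obtain S where S: "countable S" "AE \<omega> in M. X \<omega> \<in> S" using assms(3) by blast
  \<comment> \<open>Neither exceptional null set depends on \<sigma>, so one null set serves for the
    whole limit over uncountably many \<sigma>.\<close>
  from AE_atom_pos[OF assms(2) S] AE_distributed_density_pos[OF assms(7)] show ?thesis
  proof eventually_elim
    case (elim \<omega>)
    then show ?case
      by (intro scaled_error_tendsto_0 assms f) simp_all
  qed
qed

end
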